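(* Let $n\ge 2$, $\alpha\in(-n,0)$, and let $\phi$ be a Young function satisfying $$\underline\Lambda_\phi(\alpha):=\sup_{x>0}\int_0^1\frac{\phi(t^{1-\alpha}x)}{\phi(x)}\frac{dt}{t^{n+1}}<\infty\quad\text{and}\quad \overline\Lambda_\phi(\alpha):=\sup_{x>0}\int_1^\infty\frac{\phi(t^{-\alpha}x)}{\phi(x)}\frac{dt}{t^{n+1}}<\infty.$$ Then there exists a constant $C\ge1$ depending only on $n,\alpha,\phi$ such that $$\|u-u_B\|_{L^{n/|\alpha|}(B)}\le C\|u\|_{\dot{\mathbf B}^{\alpha,\phi}(B)}\quad\text{for all balls } B\subset\mathbb R^n \text{ and all } u\in\dot{\mathbf B}^{\alpha,\phi}(B),$$ and $$\inf_{c\in\mathbb R}\|u-c\|_{L^{n/|\alpha|}(\mathbb R^n)}\le C\|u\|_{\dot{\mathbf B}^{\alpha,\phi}(\mathbb R^n)}\quad\text{for all } u\in\dot{\mathbf B}^{\alpha,\phi}(\mathbb R^n).$$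
   Context: A Young function is $\phi\in C([0,\infty))$, convex, with $\phi(0)=0$, $\phi(t)>0$ for $t>0$ and $\lim_{t\to\infty}\phi(t)=\infty$. For a domain $\Omega\subset\mathbb R^n$ and $\alpha\in\mathbb R$, the homogeneous Orlicz-Besov space $\dot{\mathbf B}^{\alpha,\phi}(\Omega)$ is the space of measurable functions $u$ on $\Omega$ with finite seminorm $$\|u\|_{\dot{\mathbf B}^{\alpha,\phi}(\Omega)}:=\inf\Big\{\lambda>0:\int_\Omega\int_\Omega\phi\Big(\frac{|u(x)-u(y)|}{\lambda|x-y|^{\alpha}}\Big)\frac{dx\,dy}{|x-y|^{2n}}\le1\Big\}.$$ $u_B=\frac1{|B|}\int_B u$ denotes the average of $u$ over $B$. *)

theory Defs
  imports "HOL-Analysis.Analysis"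
begin

definition young_function :: "(real \<Rightarrow> real) \<Rightarrow> bool" where
  "young_function \<phi> \<longleftrightarrow>
     continuous_on {0..} \<phi> \<and> convex_on {0..} \<phi> \<and> \<phi> 0 = 0 \<and>
     (\<forall>t>0. \<phi> t > 0) \<and> filterlim \<phi> at_top at_top"

definition lower_Lambda :: "(real \<Rightarrow> real) \<Rightarrow> nat \<Rightarrow> real \<Rightarrow> ennreal" where
  "lower_Lambda \<phi> n \<alpha> =
     (SUP x\<in>{0<..}. \<integral>\<^sup>+ t\<in>{0<..<1}.
        ennreal (\<phi> (t powr (1 - \<alpha>) * x) / \<phi> x / t ^ (n + 1)) \<partial>lborel)"

definition upper_Lambda :: "(real \<Rightarrow> real) \<Rightarrow> nat \<Rightarrow> real \<Rightarrow> ennreal" where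
  "upper_Lambda \<phi> n \<alpha> =
     (SUP x\<in>{0<..}. \<integral>\<^sup>+ t\<in>{1<..}.
        ennreal (\<phi> (t powr (- \<alpha>) * x) / \<phi> x / t ^ (n + 1)) \<partial>lborel)"

definition besov_modular ::
  "(real \<Rightarrow> real) \<Rightarrow> real \<Rightarrow> 'a::euclidean_space set \<Rightarrow> ('a \<Rightarrow> real) \<Rightarrow> real \<Rightarrow> ennreal" where
  "besov_modular \<phi> \<alpha> \<Omega> u lam =
     (\<integral>\<^sup>+ x\<in>\<Omega>. \<integral>\<^sup>+ y\<in>\<Omega>.
        ennreal (\<phi> (\<bar>u x - u y\<bar> / (lam * norm (x - y) powr \<alpha>))
                 / norm (x - y) powr (2 * real DIM('a))) \<partial>lebesgue \<partial>lebesgue)"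

definition in_besov ::
  "(real \<Rightarrow> real) \<Rightarrow> real \<Rightarrow> 'a::euclidean_space set \<Rightarrow> ('a \<Rightarrow> real) \<Rightarrow> bool" where
  "in_besov \<phi> \<alpha> \<Omega> u \<longleftrightarrow>
     u \<in> borel_measurable (lebesgue_on \<Omega>) \<and> (\<exists>lam>0. besov_modular \<phi> \<alpha> \<Omega> u lam \<le> 1)"

definition besov_seminorm ::
  "(real \<Rightarrow> real) \<Rightarrow> real \<Rightarrow> 'a::euclidean_space set \<Rightarrow> ('a \<Rightarrow> real) \<Rightarrow> real" where
  "besov_seminorm \<phi> \<alpha> \<Omega> u = Inf {lam. lam > 0 \<and> besov_modular \<phi> \<alpha> \<Omega> u lam \<le> 1}"

definition Lp_norm :: "real \<Rightarrow> 'a::euclidean_space set \<Rightarrow> ('a \<Rightarrow> real) \<Rightarrow> ennreal" where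
  "Lp_norm p A f =
     (let I = (\<integral>\<^sup>+ x\<in>A. ennreal (\<bar>f x\<bar> powr p) \<partial>lebesgue)
      in if I = \<infinity> then \<infinity> else ennreal (enn2real I powr (1 / p)))"

definition ball_average :: "'a::euclidean_space set \<Rightarrow> ('a \<Rightarrow> real) \<Rightarrow> real" where
  "ball_average B u = (\<integral>x\<in>B. u x \<partial>lebesgue) / measure lebesgue B"

end

theory Submission
  imports Defs
begin

text \<open>
  Write \<open>s = - \<alpha>\<close> and \<open>p = n / s\<close>. Finiteness of \<open>upper_Lambda\<close> gives \<open>\<phi> (T\<^sup>s x) \<le> K T\<^sup>n \<phi> x\<close>
  for \<open>T \<ge> 1\<close>, so that the kernel \<open>\<rho> \<mapsto> \<phi> (\<tau> \<rho>\<^sup>s) / \<rho>\<^bsup>2n\<^esup>\<close> is almost decreasing.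

  Let \<open>m\<close> be a median of \<open>u\<close> on a ball \<open>B\<close>, \<open>w = (u - m) / \<lambda>\<close>, and let \<open>a \<tau>\<close> be the measure of
  \<open>{w > \<tau>}\<close>, which is at most half of \<open>|B|\<close>. If \<open>w x \<ge> 2 \<tau>\<close>, then a ball around \<open>x\<close> of measure
  comparable to \<open>a \<tau>\<close> contains a set of measure at least \<open>a \<tau>\<close> on which \<open>w \<le> \<tau>\<close>, and hence the
  inner integral \<open>F x\<close> of the modular is at least \<open>c \<phi> (\<tau> (a \<tau>)\<^bsup>1/p\<^esup>) / a \<tau>\<close>.
  Integrating this over \<open>{w > 2 \<tau>}\<close> for a \<open>\<tau>\<close> that nearly maximises \<open>\<tau> (a \<tau>)\<^bsup>1/p\<^esup>\<close> bounds
  the weak norm \<open>sup \<tau> (a \<tau>)\<^bsup>1/p\<^esup>\<close> by a constant. On bounded arguments \<open>\<phi> t \<ge> c t\<^sup>p\<close>, so the same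
  bound with \<open>\<tau> = w x / 2\<close> becomes \<open>F x \<ge> c (w x)\<^sup>p\<close>, and integration gives the strong norm.
\<close>

section \<open>Monotonicity and power growth of the Young function\<close>

lemma young_function_nonneg:
  assumes "young_function \<phi>" "0 \<le> x"
  shows "0 \<le> \<phi> x"
  using assms unfolding young_function_def by (cases "x = 0") (auto intro: less_imp_le)

text \<open>By convexity and \<open>\<phi> 0 = 0\<close> the graph lies below the chord from the
  origin to \<open>y\<close>, and \<open>x / y \<le> 1\<close>.\<close>

lemma young_function_mono:
  assumes y: "young_function \<phi>" and x: "0 \<le> x" "x \<le> y"
  shows "\<phi> x \<le> \<phi> y"
proof (cases "y = 0")
  case True
  then show ?thesis using x by simp
next
  case False
  then have y0: "y > 0" using x by simp
  have cv: "convex_on {0..} \<phi>" and p0: "\<phi> 0 = 0"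
    using y unfolding young_function_def by auto
  have "\<phi> ((1 - x / y) *\<^sub>R 0 + (x / y) *\<^sub>R y) \<le> (1 - x / y) * \<phi> 0 + (x / y) * \<phi> y"
    by (rule convex_onD[OF cv]) (use x y0 in \<open>auto simp: field_simps\<close>)
  then have "\<phi> x \<le> (x / y) * \<phi> y" using y0 p0 by simp
  also have "\<dots> \<le> 1 * \<phi> y"
    by (rule mult_right_mono) (use x y0 young_function_nonneg[OF y] in auto)
  finally show ?thesis by simp
qed

text \<open>Only the window \<open>{T<..<2*T}\<close> of the integral is kept. By monotonicity the
  integrand there is at least the constant \<open>c\<close>, and the window has length
  \<open>T\<close>, so \<open>c * T\<close> is bounded by the supremum; clearing the denominator
  \<open>(2 * T) ^ (n + 1)\<close> leaves the power \<open>T ^ n\<close>.\<close>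

lemma upper_Lambda_growth:
  assumes y: "young_function \<phi>" and up: "upper_Lambda \<phi> n \<alpha> < \<infinity>" and a: "\<alpha> < 0"
  shows "\<exists>K\<ge>1. \<forall>x>0. \<forall>T\<ge>1. \<phi> (T powr (- \<alpha>) * x) \<le> K * T ^ n * \<phi> x"
proof -
  define L where "L = enn2real (upper_Lambda \<phi> n \<alpha>)"
  have L: "upper_Lambda \<phi> n \<alpha> = ennreal L" "L \<ge> 0"
    unfolding L_def using up by auto
  define K where "K = max 1 (L * 2 ^ (n + 1))"
  have "\<phi> (T powr (- \<alpha>) * x) \<le> K * T ^ n * \<phi> x" if x: "x > 0" and T: "T \<ge> 1" for x T
  proof -
    have px: "\<phi> x > 0" using y x unfolding young_function_def by auto
    define c where "c = \<phi> (T powr (- \<alpha>) * x) / \<phi> x / (2 * T) ^ (n + 1)"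
    have c0: "c \<ge> 0" unfolding c_def using px T x
      by (auto intro!: divide_nonneg_nonneg young_function_nonneg[OF y])
    have "ennreal (c * T) = (\<integral>\<^sup>+ t. ennreal c * indicator {T<..<2*T} t \<partial>lborel)"
      using T c0 by (simp add: nn_integral_cmult_indicator ennreal_mult)
    also have "\<dots> \<le> (\<integral>\<^sup>+ t\<in>{1<..}. ennreal (\<phi> (t powr (- \<alpha>) * x) / \<phi> x / t ^ (n + 1)) \<partial>lborel)"
    proof (rule nn_integral_mono)
      fix t :: real
      show "ennreal c * indicator {T<..<2*T} t \<le>
        ennreal (\<phi> (t powr (- \<alpha>) * x) / \<phi> x / t ^ (n + 1)) * indicator {1<..} t"
      proof (cases "t \<in> {T<..<2*T}")
        case True
        have "\<phi> (T powr (- \<alpha>) * x) \<le> \<phi> (t powr (- \<alpha>) * x)"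
          by (rule young_function_mono[OF y])
            (use True T x a in \<open>auto intro!: mult_right_mono powr_mono2\<close>)
        moreover have "t ^ (n + 1) \<le> (2 * T) ^ (n + 1)"
          by (rule power_mono) (use True T in auto)
        ultimately have "c \<le> \<phi> (t powr (- \<alpha>) * x) / \<phi> x / t ^ (n + 1)"
          unfolding c_def using px T True x
          by (intro frac_le divide_right_mono) (auto intro!: divide_nonneg_nonneg young_function_nonneg[OF y])
        then show ?thesis using True T by (auto intro!: ennreal_leI)
      qed auto
    qed
    also have "\<dots> \<le> upper_Lambda \<phi> n \<alpha>"
      unfolding upper_Lambda_def by (rule SUP_upper) (use x in auto)
    finally have "c * T \<le> L" using L by simp
    then have "\<phi> (T powr (- \<alpha>) * x) \<le> L * 2 ^ (n + 1) * T ^ n * \<phi> x"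
      using px T unfolding c_def by (simp add: field_simps power_mult_distrib)
    also have "\<dots> \<le> K * T ^ n * \<phi> x"
      unfolding K_def using px T by (intro mult_right_mono) auto
    finally show ?thesis .
  qed
  then show ?thesis by (intro exI[of _ K]) (auto simp: K_def)
qed

section \<open>Lower bound for the inner integral of the modular\<close>

text \<open>The intersection contains the ball of radius \<open>R / 2\<close> whose centre is
  \<open>x\<close> moved towards \<open>z\<close> by the fraction \<open>R / (2 * r)\<close>. This
  is uniform in \<open>x\<close> up to the boundary of \<open>ball z r\<close>.\<close>

lemma measure_ball_inter_ball_ge:
  fixes x z :: "'a::euclidean_space"
  assumes x: "x \<in> ball z r" and R: "0 < R" "R \<le> 2 * r"
  shows "unit_ball_vol DIM('a) * (R / 2) ^ DIM('a) \<le> measure lebesgue (ball z r \<inter> ball x R)"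
proof -
  define t where "t = R / (2 * r)"
  have r: "r > 0" using x by (metis ball_eq_empty empty_iff not_le)
  have t: "0 < t" "t \<le> 1" "t * r = R / 2" using R r by (auto simp: t_def field_simps)
  define w where "w = x + t *\<^sub>R (z - x)"
  have d: "norm (z - x) < r" using x by (simp add: dist_norm)
  have "norm (w - x) = t * norm (z - x)" using t by (simp add: w_def)
  also have "\<dots> \<le> t * r" using d t by (intro mult_left_mono) auto
  finally have wx: "dist x w \<le> R / 2" using t by (simp add: dist_norm norm_minus_commute)
  have "z - w = (1 - t) *\<^sub>R (z - x)" by (simp add: w_def algebra_simps)
  then have "norm (z - w) = (1 - t) * norm (z - x)" using t by simp
  also have "\<dots> \<le> (1 - t) * r" using d t by (intro mult_left_mono) auto
  also have "\<dots> = r - R / 2" using t by (simp add: algebra_simps)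
  finally have wz: "dist z w \<le> r - R / 2" by (simp add: dist_norm)
  have "ball w (R / 2) \<subseteq> ball z r \<inter> ball x R"
  proof
    fix y assume "y \<in> ball w (R / 2)"
    then have "dist w y < R / 2" by simp
    then show "y \<in> ball z r \<inter> ball x R"
      using wx wz dist_triangle[of z y w] dist_triangle[of x y w] by auto
  qed
  then have "measure lebesgue (ball w (R / 2)) \<le> measure lebesgue (ball z r \<inter> ball x R)"
    by (intro measure_mono_fmeasurable) auto
  then show ?thesis using R by (simp add: content_ball)
qed

text \<open>Within a distance \<open>R\<close> of \<open>x\<close>, with \<open>R ^ n\<close>
  comparable to \<open>a\<close>, the ball has measure at least \<open>2 * a\<close>, so at least
  \<open>a\<close> of it survives the removal of \<open>A\<close>, and there \<open>w\<close>
  differs from \<open>w x\<close> by at least \<open>\<tau>\<close>. Since \<open>a\<close> is only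
  an upper bound for the measure of \<open>A\<close>, null sets \<open>A\<close> are
  covered.\<close>

lemma besov_potential_lower_bound:
  fixes \<phi> :: "real \<Rightarrow> real" and \<alpha> :: real
  assumes y: "young_function \<phi>" and \<alpha>: "\<alpha> < 0" and K: "K \<ge> 1"
    and growth: "\<And>x T. x > 0 \<Longrightarrow> T \<ge> 1 \<Longrightarrow> \<phi> (T powr (- \<alpha>) * x) \<le> K * T ^ DIM('a) * \<phi> x"
  shows "\<exists>c>0. \<forall>(z::'a::euclidean_space) r x w A \<tau> a.
     x \<in> ball z r \<longrightarrow> A \<in> sets lebesgue \<longrightarrow> x \<in> A \<longrightarrow> A \<subseteq> ball z r \<longrightarrow> 0 < a \<longrightarrow>
     measure lebesgue A \<le> a \<longrightarrow> 2 * a \<le> measure lebesgue (ball z r) \<longrightarrow> 0 < \<tau> \<longrightarrow>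
     (\<forall>y\<in>ball z r - A. \<tau> \<le> \<bar>w x - w y\<bar>) \<longrightarrow>
     ennreal (c * \<phi> (\<tau> * a powr (- \<alpha> / DIM('a))) / a) \<le>
     (\<integral>\<^sup>+ y\<in>ball z r. ennreal (\<phi> (\<bar>w x - w y\<bar> / (1 * norm (x - y) powr \<alpha>))
         / norm (x - y) powr (2 * real DIM('a))) \<partial>lebesgue)"
proof -
  define n where "n = DIM('a)"
  have n0: "n > 0" unfolding n_def by simp
  define \<omega> where "\<omega> = unit_ball_vol (real n)"
  have \<omega>: "\<omega> > 0" unfolding \<omega>_def by simp
  \<comment> \<open>With \<open>R ^ n = \<kappa> * a\<close> the inscribed ball of radius
    \<open>R / 2\<close> has measure \<open>\<omega> * \<kappa> * a / 2 ^ n\<close>, and the second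
    entry of the maximum makes this at least \<open>2 * a\<close>. The entry 1 gives
    \<open>a powr (- \<alpha> / n) \<le> R powr (- \<alpha>)\<close>.\<close>
  define \<kappa> where "\<kappa> = max 1 (2 ^ (n + 1) / \<omega>)"
  have \<kappa>: "\<kappa> \<ge> 1" "\<omega> * \<kappa> \<ge> 2 ^ (n + 1)"
    using \<omega> by (auto simp: \<kappa>_def max_def field_simps)
  define c where "c = 1 / (K * \<kappa>\<^sup>2)"
  have c: "c > 0" unfolding c_def using K \<kappa> by simp
  have "ennreal (c * \<phi> (\<tau> * a powr (- \<alpha> / n)) / a) \<le>
     (\<integral>\<^sup>+ y\<in>ball z r. ennreal (\<phi> (\<bar>w x - w y\<bar> / (1 * norm (x - y) powr \<alpha>))
         / norm (x - y) powr (2 * real n)) \<partial>lebesgue)"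
    if x: "x \<in> ball z r" and A: "A \<in> sets lebesgue" "x \<in> A" "A \<subseteq> ball z r" and a: "0 < a"
      "measure lebesgue A \<le> a" "2 * a \<le> measure lebesgue (ball z r)" and \<tau>: "0 < \<tau>"
      and w: "\<forall>y\<in>ball z r - A. \<tau> \<le> \<bar>w x - w y\<bar>"
    for z :: 'a and r x w A \<tau> a
  proof -
    define R where "R = (\<kappa> * a) powr (1 / n)"
    have R0: "R > 0" unfolding R_def using \<kappa> a by simp
    have Rn: "R ^ n = \<kappa> * a"
      unfolding R_def using \<kappa> a n0 by (simp add: powr_powr flip: powr_realpow)
    have Rs: "a powr (- \<alpha> / n) \<le> R powr (- \<alpha>)"
    proof -
      have "a powr (- \<alpha> / n) \<le> (\<kappa> * a) powr (- \<alpha> / n)"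
        by (rule powr_mono2) (use \<alpha> \<kappa> a n0 in \<open>auto simp: field_simps\<close>)
      then show ?thesis by (simp add: R_def powr_powr)
    qed
    have fin: "A \<in> fmeasurable lebesgue" "ball z r \<inter> ball x R \<in> fmeasurable lebesgue"
      using A by (auto intro: fmeasurableI2[of "ball z r"])
    have "2 * a \<le> measure lebesgue (ball z r \<inter> ball x R)"
    proof (cases "R \<le> 2 * r")
      case True
      have "2 * a \<le> \<omega> * \<kappa> * a / 2 ^ n"
        using mult_right_mono[OF \<kappa>(2), of a] a by (simp add: field_simps)
      also have "\<dots> = \<omega> * (R / 2) ^ n" by (simp add: power_divide Rn)
      also have "\<dots> \<le> measure lebesgue (ball z r \<inter> ball x R)"
        using measure_ball_inter_ball_ge[OF x R0 True] by (simp add: \<omega>_def n_def)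
      finally show ?thesis .
    next
      case False
      \<comment> \<open>Points of \<open>ball z r\<close> are less than \<open>2 * r < R\<close>
        apart, so nothing is cut off.\<close>
      have "ball z r \<subseteq> ball x R"
      proof
        fix y assume "y \<in> ball z r"
        then show "y \<in> ball x R" using x False dist_triangle[of x y z]
          by (auto simp: dist_commute)
      qed
      then have "ball z r \<inter> ball x R = ball z r" by auto
      then show ?thesis using a by simp
    qed
    moreover define S where "S = ball z r \<inter> ball x R - A"
    moreover have "measure lebesgue (ball z r \<inter> ball x R) - measure lebesgue A \<le> measure lebesgue S"
      unfolding S_def using fin by (intro measure_diff_le_measure_setdiff) auto
    ultimately have Sa: "a \<le> measure lebesgue S" using a by linarith
    have Sf: "S \<in> fmeasurable lebesgue"
      unfolding S_def using fin by (intro fmeasurable.Diff) auto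
    then have Se: "emeasure lebesgue S = ennreal (measure lebesgue S)"
      by (simp add: emeasure_eq_measure2)
    \<comment> \<open>Up to the factor \<open>K\<close>, this is the kernel at the extreme distance
      \<open>R\<close>, where \<open>R ^ n * R ^ n = (\<kappa> * a)\<^sup>2\<close>. Multiplied by
      the measure \<open>a\<close> of the surviving set it yields the claimed bound with
      \<open>c\<close>.\<close>
    define h where "h = \<phi> (\<tau> * a powr (- \<alpha> / n)) / (K * (\<kappa> * a)\<^sup>2)"
    have h0: "h \<ge> 0" unfolding h_def using K \<tau>
      by (auto intro!: divide_nonneg_nonneg young_function_nonneg[OF y])
    have "c * \<phi> (\<tau> * a powr (- \<alpha> / n)) / a = h * a"
      using a by (simp add: h_def c_def power2_eq_square field_simps)
    also have "ennreal \<dots> \<le> ennreal h * emeasure lebesgue S"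
      unfolding Se using h0 Sa a by (simp add: mult_left_mono flip: ennreal_mult)
    also have "\<dots> = (\<integral>\<^sup>+ y. ennreal h * indicator S y \<partial>lebesgue)"
      using Sf by (simp add: nn_integral_cmult_indicator)
    also have "\<dots> \<le> (\<integral>\<^sup>+ y\<in>ball z r. ennreal (\<phi> (\<bar>w x - w y\<bar> / (1 * norm (x - y) powr \<alpha>))
         / norm (x - y) powr (2 * real n)) \<partial>lebesgue)"
    proof (rule nn_integral_mono)
      fix y
      show "ennreal h * indicator S y \<le> ennreal (\<phi> (\<bar>w x - w y\<bar> / (1 * norm (x - y) powr \<alpha>))
         / norm (x - y) powr (2 * real n)) * indicator (ball z r) y"
      proof (cases "y \<in> S")
        case True
        define \<rho> where "\<rho> = norm (x - y)"
        \<comment> \<open>Positivity holds because \<open>x\<close> lies in \<open>A\<close> and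
          \<open>y\<close> does not.\<close>
        have \<rho>: "\<rho> > 0" "\<rho> < R" using True A by (auto simp: S_def \<rho>_def dist_norm)
        have "\<phi> (\<tau> * a powr (- \<alpha> / n)) \<le> \<phi> (\<tau> * R powr (- \<alpha>))"
          using Rs \<tau> by (intro young_function_mono[OF y] mult_left_mono) auto
        \<comment> \<open>Prepares the growth bound with \<open>T = R / \<rho>\<close>, which
          carries the value at distance \<open>R\<close> down to distance
          \<open>\<rho>\<close>.\<close>
        also have "\<tau> * R powr (- \<alpha>) = (R / \<rho>) powr (- \<alpha>) * (\<tau> * \<rho> powr (- \<alpha>))"
          using \<rho> R0 by (simp add: powr_divide)
        also have "\<phi> \<dots> \<le> K * (R / \<rho>) ^ n * \<phi> (\<tau> * \<rho> powr (- \<alpha>))"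
          unfolding n_def by (rule growth) (use \<rho> \<tau> in auto)
        also have "\<dots> \<le> K * (R / \<rho>) ^ n * \<phi> (\<bar>w x - w y\<bar> / (1 * \<rho> powr \<alpha>))"
        proof -
          have "\<tau> * \<rho> powr (- \<alpha>) \<le> \<bar>w x - w y\<bar> / (1 * \<rho> powr \<alpha>)"
            using w True \<rho> by (auto simp: S_def powr_minus field_simps)
          then show ?thesis
            using K R0 \<rho> \<tau> by (intro mult_left_mono young_function_mono[OF y]) auto
        qed
        finally have 1: "\<phi> (\<tau> * a powr (- \<alpha> / n)) \<le> K * (R / \<rho>) ^ n * \<phi> (\<bar>w x - w y\<bar> / (1 * \<rho> powr \<alpha>))" .
        have p0: "\<phi> (\<bar>w x - w y\<bar> / (1 * \<rho> powr \<alpha>)) \<ge> 0"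
          by (rule young_function_nonneg[OF y]) auto
        have \<rho>2: "\<rho> powr (2 * real n) = \<rho> ^ n * \<rho> ^ n"
          unfolding mult_2 powr_add using \<rho> by (simp add: powr_realpow)
        have "h \<le> K * (R / \<rho>) ^ n * \<phi> (\<bar>w x - w y\<bar> / (1 * \<rho> powr \<alpha>)) / (K * (\<kappa> * a)\<^sup>2)"
          unfolding h_def by (rule divide_right_mono[OF 1]) (use K in auto)
        also have "\<dots> = \<phi> (\<bar>w x - w y\<bar> / (1 * \<rho> powr \<alpha>)) / (\<rho> ^ n * R ^ n)"
          using K R0 \<rho> by (simp add: Rn[symmetric] power_divide power2_eq_square field_simps)
        also have "\<dots> \<le> \<phi> (\<bar>w x - w y\<bar> / (1 * \<rho> powr \<alpha>)) / (\<rho> ^ n * \<rho> ^ n)"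
          using \<rho> p0 by (intro divide_left_mono mult_left_mono power_mono) auto
        finally have "h \<le> \<phi> (\<bar>w x - w y\<bar> / (1 * \<rho> powr \<alpha>)) / \<rho> powr (2 * real n)"
          unfolding \<rho>2 .
        then show ?thesis using True by (simp add: S_def \<rho>_def ennreal_leI)
      qed auto
    qed
    finally show ?thesis .
  qed
  then show ?thesis using c unfolding n_def by (intro exI[of _ c] conjI allI impI) auto
qed

section \<open>From the weak to the strong bound on superlevel sets\<close>

lemma superlevel_set_lebesgue:
  assumes "w \<in> borel_measurable (lebesgue_on S)" "S \<in> sets lebesgue"
  shows "{x \<in> S. (\<tau>::real) < w x} \<in> sets lebesgue"
proof -
  have "w -` {\<tau><..} \<inter> space (lebesgue_on S) \<in> sets (lebesgue_on S)"
    using assms by (intro measurable_sets[of w _ borel]) auto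
  moreover have "w -` {\<tau><..} \<inter> space (lebesgue_on S) = {x \<in> S. \<tau> < w x}"
    by (auto simp: space_restrict_space)
  ultimately show ?thesis using assms(2) by (simp add: sets_restrict_space_iff)
qed

text \<open>Treating only the positive part lets the result serve both signs of a function centred
  at a median; the half-measure hypothesis supplies the condition
  \<open>2 * a \<le> measure lebesgue (ball z r)\<close> of the potential bound. The weak bound
  comes first because it confines the arguments of \<open>\<phi>\<close> to a bounded range, where
  growth gives a lower bound by the power \<open>p\<close>.\<close>

lemma besov_superlevel_bound:
  fixes \<phi> :: "real \<Rightarrow> real" and \<alpha> :: real
  assumes y: "young_function \<phi>" and \<alpha>: "\<alpha> < 0"
    and up: "upper_Lambda \<phi> DIM('a) \<alpha> < \<infinity>"
  shows "\<exists>C>0. \<forall>(z::'a::euclidean_space) r w. w \<in> borel_measurable (lebesgue_on (ball z r)) \<longrightarrow>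
     besov_modular \<phi> \<alpha> (ball z r) w 1 \<le> 1 \<longrightarrow>
     2 * measure lebesgue {x \<in> ball z r. 0 < w x} \<le> measure lebesgue (ball z r) \<longrightarrow>
     (\<integral>\<^sup>+ x\<in>{x \<in> ball z r. 0 < w x}. ennreal (w x powr (DIM('a) / - \<alpha>)) \<partial>lebesgue) \<le> ennreal C"
proof -
  define n where "n = DIM('a)"
  have n0: "n > 0" unfolding n_def by simp
  define p where "p = n / - \<alpha>"
  define q where "q = - \<alpha> / n"
  have pq: "p > 0" "q > 0" "p * q = 1" "q * p = 1"
    using n0 \<alpha> by (auto simp: p_def q_def field_simps)
  obtain K where K: "K \<ge> 1" and growth: "\<And>x T. x > 0 \<Longrightarrow> T \<ge> 1 \<Longrightarrow> \<phi> (T powr (- \<alpha>) * x) \<le> K * T ^ DIM('a) * \<phi> x"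
    using upper_Lambda_growth[OF y up \<alpha>] by blast
  \<comment> \<open>Inserting \<open>T powr (1 / - \<alpha>)\<close> for \<open>T\<close> turns the
    exponent \<open>n\<close> into \<open>p\<close>.\<close>
  have growth': "\<phi> (T * x) \<le> K * T powr p * \<phi> x" if "x > 0" "T \<ge> 1" for x T
    using growth[of x "T powr (1 / - \<alpha>)"] that \<alpha>
    by (simp add: powr_powr p_def n_def ge_one_powr_ge_zero flip: powr_realpow)
  obtain c where c: "c > 0" and pot: "\<And>(z::'a) r x w A \<tau> a.
     x \<in> ball z r \<Longrightarrow> A \<in> sets lebesgue \<Longrightarrow> x \<in> A \<Longrightarrow> A \<subseteq> ball z r \<Longrightarrow> 0 < a \<Longrightarrow>
     measure lebesgue A \<le> a \<Longrightarrow> 2 * a \<le> measure lebesgue (ball z r) \<Longrightarrow> 0 < \<tau> \<Longrightarrow>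
     \<forall>y\<in>ball z r - A. \<tau> \<le> \<bar>w x - w y\<bar> \<Longrightarrow>
     ennreal (c * \<phi> (\<tau> * a powr q) / a) \<le>
     (\<integral>\<^sup>+ y\<in>ball z r. ennreal (\<phi> (\<bar>w x - w y\<bar> / (1 * norm (x - y) powr \<alpha>))
         / norm (x - y) powr (2 * real DIM('a))) \<partial>lebesgue)"
    using besov_potential_lower_bound[OF y \<alpha> K growth] unfolding q_def n_def by blast
  have pos: "\<phi> t > 0" if "t > 0" for t using y that unfolding young_function_def by auto
  \<comment> \<open>At \<open>t0\<close> the function exceeds the bound \<open>4 powr p / c\<close>
    that a nearly maximal level would force. Below, \<open>\<beta>0\<close> is \<open>4 * t0\<close>
    because two factors 2 are lost: one for near maximality, one for halving the level.\<close>
  obtain t0 where t0: "t0 > 0" "\<phi> t0 > 4 powr p / c"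
  proof -
    have "eventually (\<lambda>t. \<phi> t > 4 powr p / c) at_top"
      using y unfolding young_function_def by (auto simp: filterlim_at_top_dense)
    then have "eventually (\<lambda>t. \<phi> t > 4 powr p / c \<and> t > 0) at_top"
      using eventually_gt_at_top by (rule eventually_conj)
    then show ?thesis using that by (auto dest!: eventually_happens)
  qed
  define \<beta>0 where "\<beta>0 = 4 * t0"
  have \<beta>0: "\<beta>0 > 0" using t0 by (simp add: \<beta>0_def)
  \<comment> \<open>Growth gives \<open>\<phi> b \<ge> \<phi> \<beta>0 * b powr p / (K * \<beta>0
    powr p)\<close> for \<open>0 < b \<le> \<beta>0\<close>; the factor \<open>2 powr p\<close>
    accounts for \<open>w x = 2 * \<tau>\<close>.\<close>
  define \<gamma> where "\<gamma> = c * \<phi> \<beta>0 / (K * \<beta>0 powr p * 2 powr p)"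
  have \<gamma>: "\<gamma> > 0" unfolding \<gamma>_def using c K \<beta>0 pos[OF \<beta>0] by simp
  have "(\<integral>\<^sup>+ x\<in>{x \<in> ball z r. 0 < w x}. ennreal (w x powr p) \<partial>lebesgue) \<le> ennreal (1 / \<gamma>)"
    if wm: "w \<in> borel_measurable (lebesgue_on (ball z r))"
      and mod: "besov_modular \<phi> \<alpha> (ball z r) w 1 \<le> 1"
      and half: "2 * measure lebesgue {x \<in> ball z r. 0 < w x} \<le> measure lebesgue (ball z r)"
    for z :: 'a and r w
  proof -
    define B where "B = ball z r"
    define A where "A \<tau> = {x \<in> B. \<tau> < w x}" for \<tau>
    define a where "a \<tau> = measure lebesgue (A \<tau>)" for \<tau>
    define F where "F x = (\<integral>\<^sup>+ y\<in>ball z r. ennreal (\<phi> (\<bar>w x - w y\<bar> / (1 * norm (x - y) powr \<alpha>))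
         / norm (x - y) powr (2 * real DIM('a))) \<partial>lebesgue)" for x
    have F: "(\<integral>\<^sup>+ x\<in>B. F x \<partial>lebesgue) \<le> 1"
      using mod unfolding besov_modular_def F_def B_def .
    have As: "A \<tau> \<in> sets lebesgue" for \<tau>
      unfolding A_def B_def by (rule superlevel_set_lebesgue[OF wm]) simp
    have Af: "A \<tau> \<in> fmeasurable lebesgue" for \<tau>
      by (rule fmeasurableI2[of B]) (use As in \<open>auto simp: A_def B_def\<close>)
    have Ae: "emeasure lebesgue (A \<tau>) = ennreal (a \<tau>)" for \<tau>
      unfolding a_def using Af by (simp add: emeasure_eq_measure2)
    have a0: "a \<tau> \<ge> 0" for \<tau> by (simp add: a_def)
    have a_mono: "a \<tau> \<le> a \<sigma>" if "\<sigma> \<le> \<tau>" for \<sigma> \<tau>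
      unfolding a_def using that As Af by (intro measure_mono_fmeasurable) (auto simp: A_def)
    have a_half: "2 * a \<tau> \<le> measure lebesgue (ball z r)" if "\<tau> \<ge> 0" for \<tau>
      using half a_mono[OF that] by (simp add: a_def A_def B_def)
    \<comment> \<open>Off \<open>A \<tau>\<close> one has \<open>w y \<le> \<tau>\<close>, so
      \<open>w x \<ge> 2 * \<tau>\<close> leaves a gap of at least \<open>\<tau>\<close>.\<close>
    have pot': "ennreal (c * \<phi> (\<tau> * m powr q) / m) \<le> F x"
      if x: "x \<in> B" "2 * \<tau> \<le> w x" and m: "0 < m" "a \<tau> \<le> m" "2 * m \<le> measure lebesgue (ball z r)"
        and \<tau>: "0 < \<tau>" for \<tau> m x
      unfolding F_def
      by (rule pot[of x z r "A \<tau>"])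
        (use x m \<tau> As in \<open>auto simp: A_def B_def a_def\<close>)
    have weak: "\<tau> * a \<tau> powr q \<le> \<beta>0" if \<tau>: "\<tau> > 0" for \<tau>
    proof (rule ccontr)
      assume neg: "\<not> \<tau> * a \<tau> powr q \<le> \<beta>0"
      \<comment> \<open>Restricting the supremum to levels up to \<open>\<tau>\<close> makes it finite without truncating \<open>w\<close>.\<close>
      define S where "S = (\<lambda>\<sigma>. \<sigma> * a \<sigma> powr q) ` {0<..\<tau>}"
      define \<beta> where "\<beta> = Sup S"
      have bdd: "bdd_above S"
      proof (rule bdd_aboveI)
        fix v assume "v \<in> S"
        then obtain \<sigma> where \<sigma>: "v = \<sigma> * a \<sigma> powr q" "0 < \<sigma>" "\<sigma> \<le> \<tau>" by (auto simp: S_def)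
        show "v \<le> \<tau> * a 0 powr q"
          unfolding \<sigma> using \<sigma> \<tau> pq a0 by (intro mult_mono powr_mono2 a_mono) auto
      qed
      have up\<beta>: "\<sigma> * a \<sigma> powr q \<le> \<beta>" if "0 < \<sigma>" "\<sigma> \<le> \<tau>" for \<sigma>
        unfolding \<beta>_def by (rule cSup_upper[OF _ bdd]) (use that in \<open>auto simp: S_def\<close>)
      have \<beta>: "\<beta> > \<beta>0" using up\<beta>[of \<tau>] \<tau> neg by auto
      have "S \<noteq> {}" "\<beta> / 2 < Sup S" using \<tau> \<beta> \<beta>0 unfolding \<beta>_def[symmetric] by (auto simp: S_def)
      then have "\<exists>v\<in>S. \<beta> / 2 < v" by (rule less_cSupD)
      then obtain \<sigma> where \<sigma>: "0 < \<sigma>" "\<sigma> \<le> \<tau>" "\<beta> / 2 < \<sigma> * a \<sigma> powr q"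
        by (auto simp: S_def)
      define \<rho> where "\<rho> = \<sigma> / 2"
      have \<rho>: "\<rho> > 0" "\<sigma> = 2 * \<rho>" "\<rho> \<le> \<tau>" using \<sigma> by (auto simp: \<rho>_def)
      have a\<sigma>: "a \<sigma> > 0" using \<sigma> \<beta> \<beta>0 a0[of \<sigma>] by (cases "a \<sigma> = 0") auto
      have a\<rho>: "a \<sigma> \<le> a \<rho>" by (rule a_mono) (use \<rho> in auto)
      then have a\<rho>0: "a \<rho> > 0" using a\<sigma> by simp
      \<comment> \<open>The half level \<open>\<rho>\<close> also competes in the supremum:
        \<open>\<rho> * a \<rho> powr q \<le> \<beta> < 2 * \<sigma> * a \<sigma> powr q\<close>.
        Hence halving the level enlarges the superlevel set by at most the factor
        \<open>4 powr p\<close>.\<close>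
      have "a \<rho> powr q \<le> \<beta> / \<rho>" using up\<beta>[of \<rho>] \<rho> by (simp add: field_simps)
      also have "\<dots> \<le> 4 * a \<sigma> powr q" using \<sigma> \<rho> by (simp add: field_simps)
      finally have "(a \<rho> powr q) powr p \<le> (4 * a \<sigma> powr q) powr p"
        using pq by (intro powr_mono2) auto
      then have ratio: "a \<rho> \<le> 4 powr p * a \<sigma>"
        using a\<rho>0 a\<sigma> pq by (simp add: powr_mult powr_powr)
      have "t0 \<le> \<rho> * a \<sigma> powr q" using \<sigma> \<rho> \<beta> by (simp add: \<beta>0_def)
      also have "\<dots> \<le> \<rho> * a \<rho> powr q"
        using \<rho> a\<rho> a\<sigma> pq by (intro mult_left_mono powr_mono2) auto
      finally have phi: "\<phi> t0 \<le> \<phi> (\<rho> * a \<rho> powr q)"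
        using t0 by (intro young_function_mono[OF y]) auto
      \<comment> \<open>On \<open>A \<sigma>\<close> the potential is at least \<open>h\<close>, by
        the bound at level \<open>\<rho>\<close>. Integrating over \<open>A \<sigma>\<close> and
        using the ratio of the two measures bounds \<open>\<phi> (\<rho> * a \<rho> powr q)\<close>
        by \<open>4 powr p / c\<close>, against the choice of \<open>t0\<close>.\<close>
      define h where "h = c * \<phi> (\<rho> * a \<rho> powr q) / a \<rho>"
      have h0: "h \<ge> 0" unfolding h_def using c a\<rho>0 \<rho>
        by (auto intro!: divide_nonneg_nonneg mult_nonneg_nonneg young_function_nonneg[OF y])
      have "ennreal (h * a \<sigma>) = (\<integral>\<^sup>+ x. ennreal h * indicator (A \<sigma>) x \<partial>lebesgue)"
        using As h0 a0 by (simp add: nn_integral_cmult_indicator Ae ennreal_mult)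
      also have "\<dots> \<le> (\<integral>\<^sup>+ x\<in>B. F x \<partial>lebesgue)"
      proof (rule nn_integral_mono)
        fix x
        show "ennreal h * indicator (A \<sigma>) x \<le> F x * indicator B x"
        proof (cases "x \<in> A \<sigma>")
          case True
          then have "ennreal h \<le> F x"
            unfolding h_def using \<rho> a\<rho>0 a_half[of \<rho>] by (intro pot') (auto simp: A_def)
          moreover have "x \<in> B" using True by (simp add: A_def)
          ultimately show ?thesis using True by simp
        qed auto
      qed
      also have "\<dots> \<le> 1" by (rule F)
      finally have "h * a \<sigma> \<le> 1" by simp
      then have "c * \<phi> (\<rho> * a \<rho> powr q) * a \<sigma> \<le> a \<rho>"
        using a\<rho>0 by (simp add: h_def field_simps)
      also have "\<dots> \<le> 4 powr p * a \<sigma>" by (rule ratio)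
      finally have "c * \<phi> (\<rho> * a \<rho> powr q) \<le> 4 powr p" using a\<sigma> by simp
      then have "\<phi> (\<rho> * a \<rho> powr q) \<le> 4 powr p / c" using c by (simp add: field_simps)
      then show False using phi t0 by linarith
    qed
    have strong: "ennreal (\<gamma> * w x powr p) \<le> F x" if x: "x \<in> A 0" for x
    proof -
      define \<tau> where "\<tau> = w x / 2"
      have \<tau>: "\<tau> > 0" "w x = 2 * \<tau>" using x by (auto simp: \<tau>_def A_def)
      \<comment> \<open>The potential bound requires a positive \<open>m\<close>. Where the
        superlevel set is null, a substitute is taken small enough for both
        \<open>2 * m \<le> measure lebesgue (ball z r)\<close> and
        \<open>\<tau> * m powr q \<le> \<beta>0\<close>.\<close>
      define m where "m = (if a \<tau> > 0 then a \<tau>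
        else min (measure lebesgue (ball z r) / 2) ((\<beta>0 / \<tau>) powr p))"
      have r0: "r > 0" using x unfolding A_def B_def by (auto intro: le_less_trans[OF zero_le_dist])
      then have B0: "measure lebesgue (ball z r) > 0" by (simp add: content_ball)
      have m: "m > 0" "a \<tau> \<le> m" "2 * m \<le> measure lebesgue (ball z r)"
        using a_half[of \<tau>] \<tau> \<beta>0 B0
        by (auto simp: m_def not_less intro: order_trans[OF _ powr_ge_zero])
      have m\<beta>: "\<tau> * m powr q \<le> \<beta>0"
      proof (cases "a \<tau> > 0")
        case True
        then show ?thesis using weak[OF \<tau>(1)] by (simp add: m_def)
      next
        case False
        then have "m powr q \<le> ((\<beta>0 / \<tau>) powr p) powr q"
          using m pq by (intro powr_mono2) (auto simp: m_def)
        also have "\<dots> = \<beta>0 / \<tau>" using \<tau> \<beta>0 pq by (simp add: powr_powr)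
        finally show ?thesis using \<tau> by (simp add: field_simps)
      qed
      define b where "b = \<tau> * m powr q"
      have b: "b > 0" "b \<le> \<beta>0" using m\<beta> m \<tau> by (auto simp: b_def)
      have bp: "b powr p = \<tau> powr p * m"
        unfolding b_def using m \<tau> pq by (simp add: powr_mult powr_powr)
      \<comment> \<open>Growth from \<open>b\<close> up to \<open>\<beta>0\<close> bounds
        \<open>\<phi> b\<close> below by a multiple of \<open>b powr p = \<tau> powr p * m\<close>;
        this \<open>m\<close> cancels the denominator of the potential bound.\<close>
      have "\<phi> \<beta>0 \<le> K * (\<beta>0 / b) powr p * \<phi> b"
        using growth'[of b "\<beta>0 / b"] b by simp
      then have "\<phi> \<beta>0 * b powr p / (K * \<beta>0 powr p) \<le> \<phi> b"
        using b \<beta>0 K by (simp add: powr_divide field_simps)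
      then have "c * (\<phi> \<beta>0 * b powr p / (K * \<beta>0 powr p)) / m \<le> c * \<phi> b / m"
        using c m by (intro divide_right_mono mult_left_mono) auto
      moreover have "\<gamma> * w x powr p = c * (\<phi> \<beta>0 * b powr p / (K * \<beta>0 powr p)) / m"
        unfolding bp \<tau>(2) \<gamma>_def using m \<tau> by (simp add: powr_mult field_simps)
      ultimately have "ennreal (\<gamma> * w x powr p) \<le> ennreal (c * \<phi> b / m)"
        by (intro ennreal_leI) simp
      also have "\<dots> \<le> F x"
        unfolding b_def using x \<tau> m by (intro pot') (auto simp: A_def)
      finally show ?thesis .
    qed
    \<comment> \<open>Extension by zero: \<open>w\<close> is known to be measurable only on the
      ball, and pulling \<open>\<gamma>\<close> out of the integral takes measurability on the whole
      space.\<close>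
    define w' where "w' x = (if x \<in> B then w x else 0)" for x
    have w'[measurable]: "w' \<in> borel_measurable lebesgue"
      unfolding w'_def B_def using wm by (intro borel_measurable_if_I) auto
    have [measurable]: "A 0 \<in> sets lebesgue" by (rule As)
    have "ennreal \<gamma> * (\<integral>\<^sup>+ x\<in>A 0. ennreal (w x powr p) \<partial>lebesgue)
        = ennreal \<gamma> * (\<integral>\<^sup>+ x\<in>A 0. ennreal (w' x powr p) \<partial>lebesgue)"
      by (intro arg_cong[where f="\<lambda>v. ennreal \<gamma> * v"] nn_integral_cong)
        (auto simp: w'_def A_def split: split_indicator)
    also have "\<dots> = (\<integral>\<^sup>+ x. ennreal \<gamma> * (ennreal (w' x powr p) * indicator (A 0) x) \<partial>lebesgue)"
      by (rule nn_integral_cmult[symmetric]) measurable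
    also have "\<dots> \<le> (\<integral>\<^sup>+ x\<in>B. F x \<partial>lebesgue)"
    proof (rule nn_integral_mono)
      fix x
      show "ennreal \<gamma> * (ennreal (w' x powr p) * indicator (A 0) x) \<le> F x * indicator B x"
      proof (cases "x \<in> A 0")
        case True
        then have "x \<in> B" by (simp add: A_def)
        then show ?thesis using strong[OF True] True \<gamma> by (simp add: w'_def ennreal_mult)
      qed auto
    qed
    also have "\<dots> \<le> 1" by (rule F)
    finally have le: "ennreal \<gamma> * (\<integral>\<^sup>+ x\<in>A 0. ennreal (w x powr p) \<partial>lebesgue) \<le> 1" .
    have "(\<integral>\<^sup>+ x\<in>A 0. ennreal (w x powr p) \<partial>lebesgue) =
      ennreal (1 / \<gamma>) * (ennreal \<gamma> * (\<integral>\<^sup>+ x\<in>A 0. ennreal (w x powr p) \<partial>lebesgue))"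
      using \<gamma> by (simp flip: mult.assoc ennreal_mult)
    also have "\<dots> \<le> ennreal (1 / \<gamma>) * 1" by (rule mult_left_mono[OF le]) simp
    finally show ?thesis by (simp add: A_def B_def)
  qed
  then show ?thesis using \<gamma> unfolding p_def n_def
    by (intro exI[of _ "1 / \<gamma>"] conjI allI impI) auto
qed

section \<open>Medians and the two-sided bound on a ball\<close>

text \<open>The median is the infimum of the levels \<open>t\<close> whose superlevel set fills at
  most half of \<open>B\<close>. Levels above it control \<open>{x \<in> B. m < u x}\<close>, levels
  below it control \<open>{x \<in> B. u x < m}\<close>, each by continuity of the measure.\<close>

lemma lebesgue_median_exists:
  fixes u :: "'a::euclidean_space \<Rightarrow> real"
  assumes u: "u \<in> borel_measurable (lebesgue_on B)" and B: "B \<in> fmeasurable lebesgue"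
    and pos: "measure lebesgue B > 0"
  shows "\<exists>m. 2 * measure lebesgue {x \<in> B. m < u x} \<le> measure lebesgue B \<and>
             2 * measure lebesgue {x \<in> B. u x < m} \<le> measure lebesgue B"
proof -
  let ?b = "measure lebesgue B"
  have Bs: "B \<in> sets lebesgue" using B by auto
  define g where "g t = measure lebesgue {x \<in> B. t < u x}" for t
  have sets: "{x \<in> B. t < u x} \<in> sets lebesgue" for t
    by (rule superlevel_set_lebesgue[OF u Bs])
  have fm: "{x \<in> B. t < u x} \<in> fmeasurable lebesgue" for t
    by (rule fmeasurableI2[OF B]) (use sets in auto)
  have sets2: "{x \<in> B. u x < t} \<in> sets lebesgue" for t
    using superlevel_set_lebesgue[of "\<lambda>x. - u x" B "- t"] u Bs by simp
  have fin: "emeasure lebesgue A \<noteq> \<infinity>" if "A \<subseteq> B" for A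
    using emeasure_mono[OF that Bs] B by (auto simp: fmeasurable_def)
  have anti: "g t \<le> g s" if "s \<le> t" for s t
    unfolding g_def using that fm sets by (intro measure_mono_fmeasurable) auto
  define S where "S = {t. 2 * g t \<le> ?b}"
  \<comment> \<open>\<open>g\<close> tends to 0 at plus infinity and to the measure of
    \<open>B\<close> at minus infinity, so \<open>S\<close> is nonempty and bounded below.\<close>
  have "(\<lambda>k::nat. g (real k)) \<longlonglongrightarrow> measure lebesgue (\<Inter>k::nat. {x \<in> B. real k < u x})"
    unfolding g_def using sets by (intro Lim_measure_decseq fin) (auto simp: decseq_def)
  moreover have "(\<Inter>k::nat. {x \<in> B. real k < u x}) = {}"
  proof -
    have "\<exists>k::nat. \<not> real k < u x" for x using reals_Archimedean2[of "u x"] by (auto dest: less_asym)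
    then show ?thesis by blast
  qed
  ultimately have "(\<lambda>k::nat. g (real k)) \<longlonglongrightarrow> 0" by simp
  then have "eventually (\<lambda>k::nat. g (real k) < ?b / 2) sequentially"
    by (rule order_tendstoD) (use pos in auto)
  then obtain k where "g (real k) < ?b / 2" by (auto dest: eventually_happens)
  then have S_ne: "S \<noteq> {}" by (auto simp: S_def intro!: exI[of _ "real k"])
  have "(\<lambda>k::nat. g (- real k)) \<longlonglongrightarrow> measure lebesgue (\<Union>k::nat. {x \<in> B. - real k < u x})"
    unfolding g_def using sets by (intro Lim_measure_incseq fin) (auto simp: incseq_def)
  moreover have "(\<Union>k::nat. {x \<in> B. - real k < u x}) = B"
  proof -
    have "\<exists>k::nat. - real k < u x" for x using reals_Archimedean2[of "- u x"] by (auto simp: minus_less_iff)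
    then show ?thesis by auto
  qed
  ultimately have "(\<lambda>k::nat. g (- real k)) \<longlonglongrightarrow> ?b" by simp
  then have "eventually (\<lambda>k::nat. ?b / 2 < g (- real k)) sequentially"
    by (rule order_tendstoD) (use pos in auto)
  then obtain k' where k': "?b / 2 < g (- real k')" by (auto dest: eventually_happens)
  have bdd: "bdd_below S"
  proof (rule bdd_belowI)
    fix t assume "t \<in> S"
    then show "- real k' \<le> t" using k' anti[of t "- real k'"] by (cases "t \<le> - real k'") (auto simp: S_def)
  qed
  define m where "m = Inf S"
  have above: "2 * g t \<le> ?b" if t: "t > m" for t
  proof -
    obtain s where "s \<in> S" "s < t" using t cInf_less_iff[OF S_ne bdd, of t] unfolding m_def by blast
    then show ?thesis using anti[of s t] by (auto simp: S_def)
  qed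
  have below: "2 * g t > ?b" if "t < m" for t
    using that cInf_lower[OF _ bdd, of t]
    by (cases "t \<in> S") (auto simp: m_def, simp add: S_def)
  \<comment> \<open>The superlevel set at \<open>m\<close> is the increasing union of those at
    levels strictly above \<open>m\<close>, so their bound passes to the limit.\<close>
  have "(\<lambda>k::nat. g (m + 1 / Suc k)) \<longlonglongrightarrow> measure lebesgue (\<Union>k::nat. {x \<in> B. m + 1 / Suc k < u x})"
    unfolding g_def
  proof (intro Lim_measure_incseq fin)
    show "incseq (\<lambda>k. {x \<in> B. m + 1 / real (Suc k) < u x})"
    proof (rule incseq_SucI)
      fix k
      have "1 / real (Suc (Suc k)) \<le> 1 / real (Suc k)" by (intro frac_le) auto
      then show "{x \<in> B. m + 1 / real (Suc k) < u x} \<subseteq> {x \<in> B. m + 1 / real (Suc (Suc k)) < u x}"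
        by auto
    qed
  qed (use sets in auto)
  moreover have "(\<Union>k::nat. {x \<in> B. m + 1 / Suc k < u x}) = {x \<in> B. m < u x}"
  proof -
    have "\<exists>k::nat. m + 1 / Suc k < u x" if "m < u x" for x
      using reals_Archimedean[of "u x - m"] that by (auto simp: inverse_eq_divide algebra_simps)
    moreover have "m < m + 1 / Suc k" for k :: nat by simp
    ultimately show ?thesis by (blast intro: less_trans)
  qed
  ultimately have "(\<lambda>k::nat. g (m + 1 / Suc k)) \<longlonglongrightarrow> g m" by (simp add: g_def)
  moreover have "g (m + 1 / Suc k) \<le> ?b / 2" for k :: nat
    using above[of "m + 1 / Suc k"] by simp
  ultimately have "g m \<le> ?b / 2"
    by (intro LIMSEQ_le_const2) blast+
  moreover have "measure lebesgue {x \<in> B. u x < m} \<le> ?b / 2"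
  proof -
    have "(\<lambda>k::nat. measure lebesgue {x \<in> B. u x < m - 1 / Suc k}) \<longlonglongrightarrow>
        measure lebesgue (\<Union>k::nat. {x \<in> B. u x < m - 1 / Suc k})"
    proof (intro Lim_measure_incseq fin)
      show "incseq (\<lambda>k. {x \<in> B. u x < m - 1 / real (Suc k)})"
      proof (rule incseq_SucI)
        fix k
        have "1 / real (Suc (Suc k)) \<le> 1 / real (Suc k)" by (intro frac_le) auto
        then show "{x \<in> B. u x < m - 1 / real (Suc k)} \<subseteq> {x \<in> B. u x < m - 1 / real (Suc (Suc k))}"
          by auto
      qed
    qed (use sets2 in auto)
    moreover have "(\<Union>k::nat. {x \<in> B. u x < m - 1 / Suc k}) = {x \<in> B. u x < m}"
    proof -
      have "\<exists>k::nat. u x < m - 1 / Suc k" if "u x < m" for x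
        using reals_Archimedean[of "m - u x"] that by (auto simp: inverse_eq_divide algebra_simps)
      moreover have "m - 1 / Suc k < m" for k :: nat by simp
      ultimately show ?thesis by (blast intro: less_trans)
    qed
    ultimately have lim: "(\<lambda>k::nat. measure lebesgue {x \<in> B. u x < m - 1 / Suc k}) \<longlonglongrightarrow>
        measure lebesgue {x \<in> B. u x < m}" by simp
    \<comment> \<open>A level below \<open>m\<close> is outside \<open>S\<close>: more than half of
      \<open>B\<close> lies above it, hence less than half lies below it.\<close>
    have "measure lebesgue {x \<in> B. u x < m - 1 / Suc k} \<le> ?b / 2" for k :: nat
    proof -
      let ?t = "m - 1 / Suc k"
      have "measure lebesgue {x \<in> B. u x < ?t} \<le> measure lebesgue (B - {x \<in> B. ?t < u x})"
        using sets sets2 Bs by (intro measure_mono_fmeasurable fmeasurable.Diff B fm) auto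
      also have "\<dots> = ?b - g ?t"
        unfolding g_def by (rule measurable_measure_Diff[OF B sets]) auto
      also have "\<dots> \<le> ?b / 2" using below[of ?t] by auto
      finally show ?thesis .
    qed
    then show ?thesis by (intro LIMSEQ_le_const2[OF lim]) auto
  qed
  ultimately show ?thesis by (intro exI[of _ m]) (auto simp: g_def)
qed

text \<open>Only differences enter the modular, so shift and sign drop out and \<open>lam\<close>
  can be moved into the function. This reduces both signed parts to the normalised case.\<close>

lemma besov_modular_rescale:
  fixes u :: "'a::euclidean_space \<Rightarrow> real"
  assumes "lam > 0" "\<bar>k\<bar> = 1"
  shows "besov_modular \<phi> \<alpha> S (\<lambda>x. k * (u x - m) / lam) 1 = besov_modular \<phi> \<alpha> S u lam"
proof -
  have "\<bar>k * (u x - m) / lam - k * (u y - m) / lam\<bar> = \<bar>u x - u y\<bar> / lam" for x y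
  proof -
    have "k * (u x - m) / lam - k * (u y - m) / lam = k * (u x - u y) / lam"
      using assms by (simp add: field_simps)
    then show ?thesis using assms by (simp add: abs_mult)
  qed
  then show ?thesis unfolding besov_modular_def by simp
qed

text \<open>At a median both \<open>(u - m) / lam\<close> and its negative are positive on at most
  half of the ball, so the one-sided bound applies to each. The two constants add up, and undoing
  the scaling produces the power of \<open>lam\<close>.\<close>

lemma besov_median_bound:
  fixes \<phi> :: "real \<Rightarrow> real" and \<alpha> :: real
  assumes y: "young_function \<phi>" and \<alpha>: "\<alpha> < 0"
    and up: "upper_Lambda \<phi> DIM('a) \<alpha> < \<infinity>"
  shows "\<exists>D>0. \<forall>(z::'a::euclidean_space) r u lam. r > 0 \<longrightarrow> lam > 0 \<longrightarrow>
     u \<in> borel_measurable (lebesgue_on (ball z r)) \<longrightarrow>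
     besov_modular \<phi> \<alpha> (ball z r) u lam \<le> 1 \<longrightarrow>
     (\<exists>m. (\<integral>\<^sup>+ x\<in>ball z r. ennreal (\<bar>u x - m\<bar> powr (DIM('a) / \<bar>\<alpha>\<bar>)) \<partial>lebesgue)
        \<le> ennreal (D * lam powr (DIM('a) / \<bar>\<alpha>\<bar>)))"
proof -
  define p where "p = DIM('a) / \<bar>\<alpha>\<bar>"
  have p: "p = DIM('a) / - \<alpha>" "p > 0" using \<alpha> by (auto simp: p_def divide_less_0_iff)
  obtain C where C: "C > 0" and bound: "\<And>(z::'a) r w. w \<in> borel_measurable (lebesgue_on (ball z r)) \<Longrightarrow>
     besov_modular \<phi> \<alpha> (ball z r) w 1 \<le> 1 \<Longrightarrow>
     2 * measure lebesgue {x \<in> ball z r. 0 < w x} \<le> measure lebesgue (ball z r) \<Longrightarrow>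
     (\<integral>\<^sup>+ x\<in>{x \<in> ball z r. 0 < w x}. ennreal (w x powr p) \<partial>lebesgue) \<le> ennreal C"
    using besov_superlevel_bound[OF y \<alpha> up] unfolding p by blast
  have "\<exists>m. (\<integral>\<^sup>+ x\<in>ball z r. ennreal (\<bar>u x - m\<bar> powr p) \<partial>lebesgue) \<le> ennreal (2 * C * lam powr p)"
    if r: "r > 0" and lam: "lam > 0" and u: "u \<in> borel_measurable (lebesgue_on (ball z r))"
      and mod: "besov_modular \<phi> \<alpha> (ball z r) u lam \<le> 1" for z :: 'a and r u lam
  proof -
    let ?B = "ball z r"
    have "measure lebesgue ?B > 0" using r by (simp add: content_ball)
    then obtain m where m: "2 * measure lebesgue {x \<in> ?B. m < u x} \<le> measure lebesgue ?B"
        "2 * measure lebesgue {x \<in> ?B. u x < m} \<le> measure lebesgue ?B"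
      using lebesgue_median_exists[OF u lmeasurable_ball] by blast
    define w where "w k x = k * (u x - m) / lam" for k :: real and x
    define P where "P k = {x \<in> ?B. 0 < w k x}" for k
    have P1: "P 1 = {x \<in> ?B. m < u x}" and P2: "P (- 1) = {x \<in> ?B. u x < m}"
      using lam by (auto simp: P_def w_def zero_less_divide_iff divide_less_0_iff)
    have wm: "w k \<in> borel_measurable (lebesgue_on ?B)" for k
      unfolding w_def using u by measurable
    have I: "(\<integral>\<^sup>+ x\<in>P k. ennreal (w k x powr p) \<partial>lebesgue) \<le> ennreal C"
      if k: "k = 1 \<or> k = - 1" for k
      unfolding P_def
    proof (rule bound[OF wm])
      show "besov_modular \<phi> \<alpha> ?B (w k) 1 \<le> 1"
        unfolding w_def using k mod by (subst besov_modular_rescale[OF lam]) auto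
      show "2 * measure lebesgue {x \<in> ?B. 0 < w k x} \<le> measure lebesgue ?B"
        using m k P1 P2 by (auto simp: P_def)
    qed
    define w' where "w' k x = (if x \<in> ?B then w k x else 0)" for k x
    have [measurable]: "w' k \<in> borel_measurable lebesgue" for k
      unfolding w'_def using wm by (intro borel_measurable_if_I) auto
    have P_sets[measurable]: "P k \<in> sets lebesgue" for k
      unfolding P_def by (rule superlevel_set_lebesgue[OF wm]) simp
    have G_eq: "ennreal (w k x powr p) * indicator (P k) x = ennreal (w' k x powr p) * indicator (P k) x" for k x
      by (auto simp: w'_def P_def split: split_indicator)
    \<comment> \<open>Splits the ball by the sign of \<open>u x - m\<close>; points with
      \<open>u x = m\<close> contribute 0, since \<open>0 powr p = 0\<close>.\<close>
    have "(\<integral>\<^sup>+ x\<in>?B. ennreal (\<bar>u x - m\<bar> powr p) \<partial>lebesgue) =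
      (\<integral>\<^sup>+ x. ennreal (lam powr p) * (ennreal (w' 1 x powr p) * indicator (P 1) x
         + ennreal (w' (- 1) x powr p) * indicator (P (- 1)) x) \<partial>lebesgue)"
    proof (rule nn_integral_cong)
      fix x
      have scale: "lam powr p * (t / lam) powr p = t powr p" if "t > 0" for t
        using lam that by (simp add: powr_divide)
      show "ennreal (\<bar>u x - m\<bar> powr p) * indicator ?B x =
        ennreal (lam powr p) * (ennreal (w' 1 x powr p) * indicator (P 1) x
         + ennreal (w' (- 1) x powr p) * indicator (P (- 1)) x)"
      proof (cases "x \<in> ?B")
        case True
        consider "u x > m" | "u x = m" | "u x < m" by linarith
        then show ?thesis
        proof cases
          case 1
          then show ?thesis unfolding P1 P2 using True scale[of "u x - m"]
            by (simp add: w'_def w_def flip: ennreal_mult)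
        next
          case 2
          then show ?thesis unfolding P1 P2 using True by simp
        next
          case 3
          then show ?thesis unfolding P1 P2 using True scale[of "m - u x"]
            by (simp add: w'_def w_def flip: ennreal_mult)
        qed
      next
        case False
        then show ?thesis by (simp add: P_def)
      qed
    qed
    also have "\<dots> = ennreal (lam powr p) * ((\<integral>\<^sup>+ x\<in>P 1. ennreal (w' 1 x powr p) \<partial>lebesgue)
         + (\<integral>\<^sup>+ x\<in>P (- 1). ennreal (w' (- 1) x powr p) \<partial>lebesgue))"
      by (simp add: nn_integral_cmult nn_integral_add)
    also have "\<dots> \<le> ennreal (lam powr p) * (ennreal C + ennreal C)"
      using I[of 1] I[of "- 1"] unfolding G_eq by (intro mult_left_mono add_mono) auto
    also have "\<dots> = ennreal (2 * C * lam powr p)"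
      using C by (simp add: mult.commute flip: ennreal_mult ennreal_plus)
    finally show ?thesis by blast
  qed
  then show ?thesis using C unfolding p_def by (intro exI[of _ "2 * C"]) simp
qed

section \<open>From medians to averages\<close>

text \<open>The larger of the two distances to \<open>c\<close> is at least half of
  \<open>\<bar>a - b\<bar>\<close>. The argument covers every \<open>p > 0\<close>, including
  exponents for which the power is not convex.\<close>

lemma powr_abs_diff_le:
  fixes a b c p :: real
  assumes "p > 0"
  shows "\<bar>a - b\<bar> powr p \<le> 2 powr p * (\<bar>a - c\<bar> powr p + \<bar>c - b\<bar> powr p)"
proof -
  have "\<bar>a - b\<bar> powr p \<le> (2 * max \<bar>a - c\<bar> \<bar>c - b\<bar>) powr p"
  proof (rule powr_mono2)
    have "\<bar>a - b\<bar> \<le> \<bar>a - c\<bar> + \<bar>c - b\<bar>" by linarith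
    also have "\<dots> \<le> max \<bar>a - c\<bar> \<bar>c - b\<bar> + max \<bar>a - c\<bar> \<bar>c - b\<bar>"
      by (rule add_mono[OF max.cobounded1 max.cobounded2])
    finally show "\<bar>a - b\<bar> \<le> 2 * max \<bar>a - c\<bar> \<bar>c - b\<bar>" unfolding mult_2 .
  qed (use assms in auto)
  also have "\<dots> = 2 powr p * max \<bar>a - c\<bar> \<bar>c - b\<bar> powr p"
    by (simp add: powr_mult)
  also have "\<dots> \<le> 2 powr p * (\<bar>a - c\<bar> powr p + \<bar>c - b\<bar> powr p)"
    by (intro mult_left_mono) (auto simp: max_def)
  finally show ?thesis .
qed

text \<open>The average differs from \<open>m\<close> by at most the mean of
  \<open>\<bar>u - m\<bar>\<close>, which is at most
  \<open>2 * (E / measure lebesgue B) powr (1 / p)\<close>. Recentring therefore costs only a factor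
  depending on \<open>p\<close>.\<close>

lemma average_deviation_bound:
  fixes u :: "'a::euclidean_space \<Rightarrow> real"
  assumes u: "u \<in> borel_measurable (lebesgue_on B)" and B: "B \<in> fmeasurable lebesgue"
    and pos: "measure lebesgue B > 0" and p: "p \<ge> 1" and E: "E > 0"
    and I: "(\<integral>\<^sup>+ x\<in>B. ennreal (\<bar>u x - m\<bar> powr p) \<partial>lebesgue) \<le> ennreal E"
  shows "(\<integral>\<^sup>+ x\<in>B. ennreal (\<bar>u x - ball_average B u\<bar> powr p) \<partial>lebesgue)
           \<le> ennreal (2 powr p * (1 + 2 powr p) * E)"
proof -
  let ?b = "measure lebesgue B"
  have Bs[measurable]: "B \<in> sets lebesgue" using B by auto
  have Be: "emeasure lebesgue B = ennreal ?b" using B by (simp add: emeasure_eq_measure2)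
  define f where "f x = (if x \<in> B then u x - m else 0)" for x
  have f[measurable]: "f \<in> borel_measurable lebesgue"
    unfolding f_def using u by (intro borel_measurable_if_I) auto
  have If: "(\<integral>\<^sup>+ x. ennreal (\<bar>f x\<bar> powr p) * indicator B x \<partial>lebesgue) \<le> ennreal E"
    by (rule order_trans[OF eq_refl I], rule nn_integral_cong)
      (auto simp: f_def split: split_indicator)
  \<comment> \<open>\<open>\<delta>\<close> bounds the mean of order \<open>p\<close> of
    \<open>u - m\<close>, and \<open>k\<close> below equals \<open>\<delta> powr (1 - p)\<close>.
    With this choice the two terms of the integrated pointwise bound are equal.\<close>
  define \<delta> where "\<delta> = (E / ?b) powr (1 / p)"
  have \<delta>: "\<delta> > 0" unfolding \<delta>_def using E pos by simp
  have \<delta>p: "\<delta> powr p = E / ?b" unfolding \<delta>_def using E pos p by (simp add: powr_powr)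
  define k where "k = \<delta> / (E / ?b)"
  have k: "k \<ge> 0" unfolding k_def using \<delta> E pos by simp
  \<comment> \<open>The pointwise bound \<open>t \<le> \<delta> + \<delta>\<^sup>1\<^sup>-\<^sup>p t\<^sup>p\<close> replaces Jensen's inequality.\<close>
  have pt: "t \<le> \<delta> + k * t powr p" if "t \<ge> 0" for t
  proof (cases "t \<le> \<delta>")
    case True
    have "0 \<le> k * t powr p" using k by simp
    then show ?thesis using True by linarith
  next
    case False
    have "t / \<delta> \<le> (t / \<delta>) powr p"
      using powr_mono[OF p, of "t / \<delta>"] False \<delta> by simp
    also have "\<dots> = t powr p / (E / ?b)" using that \<delta> by (simp add: powr_divide \<delta>p)
    finally have "t \<le> k * t powr p" using \<delta> by (simp add: k_def field_simps)
    then show ?thesis using \<delta> by linarith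
  qed
  have "(\<integral>\<^sup>+ x. ennreal \<bar>f x\<bar> \<partial>lebesgue) \<le>
      (\<integral>\<^sup>+ x. ennreal \<delta> * indicator B x
        + ennreal (k) * (ennreal (\<bar>f x\<bar> powr p) * indicator B x) \<partial>lebesgue)"
  proof (rule nn_integral_mono)
    fix x
    show "ennreal \<bar>f x\<bar> \<le> ennreal \<delta> * indicator B x
        + ennreal (k) * (ennreal (\<bar>f x\<bar> powr p) * indicator B x)"
    proof (cases "x \<in> B")
      case True
      have "ennreal \<bar>f x\<bar> \<le> ennreal (\<delta> + k * \<bar>f x\<bar> powr p)"
        by (rule ennreal_leI[OF pt]) simp
      also have "\<dots> = ennreal \<delta> + ennreal (k) * ennreal (\<bar>f x\<bar> powr p)"
        using \<delta> k by (subst ennreal_plus) (auto simp: ennreal_mult)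
      finally show ?thesis using True by simp
    qed (simp add: f_def)
  qed
  also have "\<dots> = ennreal \<delta> * emeasure lebesgue B
      + ennreal (k) * (\<integral>\<^sup>+ x. ennreal (\<bar>f x\<bar> powr p) * indicator B x \<partial>lebesgue)"
    by (simp add: nn_integral_add nn_integral_cmult nn_integral_cmult_indicator del: emeasure_completion)
  also have "\<dots> \<le> ennreal \<delta> * ennreal ?b + ennreal (k) * ennreal E"
    unfolding Be by (intro add_left_mono mult_left_mono If) simp
  also have "\<dots> = ennreal (\<delta> * ?b + k * E)"
    using \<delta> E k by (simp add: ennreal_mult ennreal_plus)
  also have "\<delta> * ?b + k * E = 2 * \<delta> * ?b" using E by (simp add: k_def)
  finally have If1: "(\<integral>\<^sup>+ x. ennreal \<bar>f x\<bar> \<partial>lebesgue) \<le> ennreal (2 * \<delta> * ?b)" .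
  \<comment> \<open>Integrability makes \<open>ball_average\<close> a genuine average instead of the
    default value 0 of the Bochner integral.\<close>
  have fint: "integrable lebesgue f"
    by (rule integrableI_bounded) (use If1 in \<open>auto intro: le_less_trans\<close>)
  have "ennreal \<bar>\<integral>x. f x \<partial>lebesgue\<bar> \<le> (\<integral>\<^sup>+ x. ennreal \<bar>f x\<bar> \<partial>lebesgue)"
    using integral_norm_bound_ennreal[OF fint] by simp
  with If1 have "ennreal \<bar>\<integral>x. f x \<partial>lebesgue\<bar> \<le> ennreal (2 * \<delta> * ?b)" by (rule order_trans[rotated])
  then have avg: "\<bar>\<integral>x. f x \<partial>lebesgue\<bar> \<le> 2 * \<delta> * ?b" using \<delta> pos by (simp add: ennreal_le_iff)
  have mint: "integrable lebesgue (\<lambda>x. m * indicator B x)"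
    using Be by (intro integrable_mult_right integrable_real_indicator) (auto simp del: emeasure_completion)
  have "(\<integral>x\<in>B. u x \<partial>lebesgue) = (\<integral>x. f x + m * indicator B x \<partial>lebesgue)"
    unfolding set_lebesgue_integral_def
    by (intro Bochner_Integration.integral_cong) (auto simp: f_def split: split_indicator)
  also have "\<dots> = (\<integral>x. f x \<partial>lebesgue) + m * ?b"
    using fint mint by simp
  finally have "ball_average B u - m = (\<integral>x. f x \<partial>lebesgue) / ?b"
    unfolding ball_average_def using pos by (simp add: field_simps)
  then have "\<bar>m - ball_average B u\<bar> = \<bar>\<integral>x. f x \<partial>lebesgue\<bar> / ?b"
    using pos by (subst abs_minus_commute) simp
  also have "\<dots> \<le> 2 * \<delta>" using avg pos by (simp add: field_simps)
  finally have "\<bar>m - ball_average B u\<bar> powr p \<le> (2 * \<delta>) powr p" using p by (intro powr_mono2) auto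
  also have "\<dots> = 2 powr p * (E / ?b)" using \<delta> by (simp add: powr_mult \<delta>p)
  finally have mb: "\<bar>m - ball_average B u\<bar> powr p \<le> 2 powr p * (E / ?b)" .
  \<comment> \<open>Share of the constant \<open>m - ball_average B u\<close> in the quasi-triangle
    inequality; integrated over \<open>B\<close> it gives
    \<open>2 powr p * 2 powr p * E\<close>.\<close>
  define h where "h = 2 powr p * (2 powr p * (E / ?b))"
  have h: "h \<ge> 0" unfolding h_def using E pos by simp
  have "(\<integral>\<^sup>+ x\<in>B. ennreal (\<bar>u x - ball_average B u\<bar> powr p) \<partial>lebesgue) \<le>
     (\<integral>\<^sup>+ x. ennreal (2 powr p) * (ennreal (\<bar>f x\<bar> powr p) * indicator B x)
        + ennreal (h) * indicator B x \<partial>lebesgue)"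
  proof (rule nn_integral_mono)
    fix x
    show "ennreal (\<bar>u x - ball_average B u\<bar> powr p) * indicator B x \<le>
       ennreal (2 powr p) * (ennreal (\<bar>f x\<bar> powr p) * indicator B x)
        + ennreal (h) * indicator B x"
    proof (cases "x \<in> B")
      case True
      have "\<bar>u x - ball_average B u\<bar> powr p \<le>
          2 powr p * (\<bar>u x - m\<bar> powr p + \<bar>m - ball_average B u\<bar> powr p)"
        by (rule powr_abs_diff_le) (use p in auto)
      also have "\<dots> \<le> 2 powr p * (\<bar>f x\<bar> powr p + 2 powr p * (E / ?b))"
        using mb True by (intro mult_left_mono add_mono) (auto simp: f_def)
      finally have "ennreal (\<bar>u x - ball_average B u\<bar> powr p) \<le>
          ennreal (2 powr p * \<bar>f x\<bar> powr p + h)"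
        by (intro ennreal_leI) (simp add: h_def algebra_simps)
      also have "\<dots> = ennreal (2 powr p) * ennreal (\<bar>f x\<bar> powr p)
          + ennreal (h)"
        using E h by (subst ennreal_plus) (auto simp: ennreal_mult)
      finally show ?thesis using True by simp
    qed auto
  qed
  also have "\<dots> = ennreal (2 powr p) * (\<integral>\<^sup>+ x. ennreal (\<bar>f x\<bar> powr p) * indicator B x \<partial>lebesgue)
      + ennreal (h) * emeasure lebesgue B"
    by (simp add: nn_integral_add nn_integral_cmult nn_integral_cmult_indicator del: emeasure_completion)
  also have "\<dots> \<le> ennreal (2 powr p) * ennreal E
      + ennreal (h) * ennreal ?b"
    unfolding Be by (intro add_right_mono mult_left_mono If) simp
  also have "\<dots> = ennreal (2 powr p * E + h * ?b)"
    using E h by (subst ennreal_plus) (auto simp: ennreal_mult)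
  also have "2 powr p * E + h * ?b = 2 powr p * (1 + 2 powr p) * E"
    using pos by (simp add: h_def field_simps)
  finally show ?thesis .
qed

section \<open>Norms and the infimum defining the seminorm\<close>

text \<open>Taking the root makes the bound linear in \<open>lam\<close>, the form that passes to
  the infimum.\<close>

lemma Lp_norm_le:
  assumes I: "(\<integral>\<^sup>+ x\<in>A. ennreal (\<bar>f x\<bar> powr p) \<partial>lebesgue) \<le> ennreal (D * lam powr p)"
    and p: "p > 0" and D: "D \<ge> 0" and lam: "lam > 0"
  shows "Lp_norm p A f \<le> ennreal (D powr (1 / p) * lam)"
proof -
  let ?I = "\<integral>\<^sup>+ x\<in>A. ennreal (\<bar>f x\<bar> powr p) \<partial>lebesgue"
  have fin: "?I \<noteq> \<infinity>" using I by (auto simp: top_unique)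
  have "enn2real ?I \<le> D * lam powr p" using I D by (intro enn2real_leI) auto
  then have "enn2real ?I powr (1 / p) \<le> (D * lam powr p) powr (1 / p)"
    using p by (intro powr_mono2) auto
  also have "\<dots> = D powr (1 / p) * lam" using p D lam by (simp add: powr_mult powr_powr)
  finally show ?thesis unfolding Lp_norm_def Let_def using fin by (simp add: ennreal_leI)
qed

text \<open>One admissible \<open>lam\<close> makes \<open>N\<close> finite; then
  \<open>N / C\<close> is a lower bound of all admissible values, hence of their infimum, attained
  or not. A vanishing seminorm is included.\<close>

lemma le_besov_seminorm:
  assumes ex: "\<exists>lam>0. besov_modular \<phi> \<alpha> S u lam \<le> 1" and C: "C > 0"
    and N: "\<And>lam. lam > 0 \<Longrightarrow> besov_modular \<phi> \<alpha> S u lam \<le> 1 \<Longrightarrow> N \<le> ennreal (C * lam)"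
  shows "N \<le> ennreal (C * besov_seminorm \<phi> \<alpha> S u)"
proof -
  obtain l where "l > 0" "besov_modular \<phi> \<alpha> S u l \<le> 1" using ex by blast
  then have "N \<le> ennreal (C * l)" by (rule N)
  then have "N < \<infinity>" by (rule le_less_trans) simp
  then obtain v where v: "N = ennreal v" "v \<ge> 0" by (cases N) auto
  have "v / C \<le> besov_seminorm \<phi> \<alpha> S u"
    unfolding besov_seminorm_def
  proof (rule cInf_greatest)
    fix lam assume "lam \<in> {lam. lam > 0 \<and> besov_modular \<phi> \<alpha> S u lam \<le> 1}"
    then have "ennreal v \<le> ennreal (C * lam)" "lam > 0" using N v by auto
    then show "v / C \<le> lam" using C by (simp add: ennreal_le_iff field_simps)
  qed (use ex in auto)
  then show ?thesis unfolding v using C by (intro ennreal_leI) (simp add: field_simps)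
qed

section \<open>Passage from balls to the whole space\<close>

lemma besov_modular_mono_set:
  assumes "S \<subseteq> T"
  shows "besov_modular \<phi> \<alpha> S u lam \<le> besov_modular \<phi> \<alpha> T u lam"
  unfolding besov_modular_def
  by (intro nn_integral_mono mult_mono) (use assms in \<open>auto split: split_indicator\<close>)

text \<open>The centring constants on an exhausting sequence of balls are bounded, so a subsequence
  converges, and Fatou's lemma passes to the limit.\<close>

lemma global_deviation_bound:
  fixes u :: "'a::euclidean_space \<Rightarrow> real"
  assumes u: "u \<in> borel_measurable lebesgue" and p: "p > 0" and E: "E > 0"
    and I: "\<And>r. r > 0 \<Longrightarrow> \<exists>m. (\<integral>\<^sup>+ x\<in>ball 0 r. ennreal (\<bar>u x - m\<bar> powr p) \<partial>lebesgue) \<le> ennreal E"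
  shows "\<exists>c. (\<integral>\<^sup>+ x. ennreal (\<bar>u x - c\<bar> powr p) \<partial>lebesgue) \<le> ennreal E"
proof -
  note [measurable] = u
  have [measurable]: "ball (0::'a) r \<in> sets lebesgue" for r by simp
  have "\<exists>m. (\<integral>\<^sup>+ x\<in>ball 0 (real (Suc k)). ennreal (\<bar>u x - m\<bar> powr p) \<partial>lebesgue) \<le> ennreal E" for k
    by (rule I) simp
  then obtain m where m: "\<And>k. (\<integral>\<^sup>+ x\<in>ball 0 (real (Suc k)). ennreal (\<bar>u x - m k\<bar> powr p) \<partial>lebesgue) \<le> ennreal E"
    by metis
  let ?B = "ball (0::'a) 1"
  let ?b = "measure lebesgue ?B"
  have b: "?b > 0" by (simp add: content_ball)
  have Be: "emeasure lebesgue ?B = ennreal ?b"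
    by (rule emeasure_eq_measure2) simp
  have m1: "(\<integral>\<^sup>+ x\<in>?B. ennreal (\<bar>u x - m k\<bar> powr p) \<partial>lebesgue) \<le> ennreal E" for k
  proof -
    have "(\<integral>\<^sup>+ x\<in>?B. ennreal (\<bar>u x - m k\<bar> powr p) \<partial>lebesgue) \<le>
        (\<integral>\<^sup>+ x\<in>ball 0 (real (Suc k)). ennreal (\<bar>u x - m k\<bar> powr p) \<partial>lebesgue)"
      by (intro nn_integral_mono mult_left_mono) (auto split: split_indicator)
    then show ?thesis using m by (rule order_trans)
  qed
  \<comment> \<open>All balls of the sequence contain the unit ball, where \<open>u\<close> is close
    in the mean to both \<open>m k\<close> and \<open>m 0\<close>. Integrating the quasi-triangle
    inequality over it gives this bound on their distance.\<close>
  define M where "M = (2 powr p * (2 * E) / ?b) powr (1 / p)"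
  have bound: "\<bar>m k - m 0\<bar> \<le> M" for k
  proof -
    have "ennreal (\<bar>m k - m 0\<bar> powr p * ?b) = (\<integral>\<^sup>+ x. ennreal (\<bar>m k - m 0\<bar> powr p) * indicator ?B x \<partial>lebesgue)"
      by (simp add: nn_integral_cmult_indicator Be ennreal_mult del: emeasure_completion)
    also have "\<dots> \<le> (\<integral>\<^sup>+ x. ennreal (2 powr p) * (ennreal (\<bar>u x - m k\<bar> powr p) * indicator ?B x
        + ennreal (\<bar>u x - m 0\<bar> powr p) * indicator ?B x) \<partial>lebesgue)"
    proof (rule nn_integral_mono)
      fix x
      have "ennreal (\<bar>m k - m 0\<bar> powr p) \<le> ennreal (2 powr p * (\<bar>u x - m k\<bar> powr p + \<bar>u x - m 0\<bar> powr p))"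
        using powr_abs_diff_le[OF p, of "m k" "m 0" "u x"]
        by (intro ennreal_leI) (simp add: abs_minus_commute)
      also have "\<dots> = ennreal (2 powr p) * (ennreal (\<bar>u x - m k\<bar> powr p) + ennreal (\<bar>u x - m 0\<bar> powr p))"
        by (simp add: ennreal_mult ennreal_plus)
      finally show "ennreal (\<bar>m k - m 0\<bar> powr p) * indicator ?B x \<le>
        ennreal (2 powr p) * (ennreal (\<bar>u x - m k\<bar> powr p) * indicator ?B x
        + ennreal (\<bar>u x - m 0\<bar> powr p) * indicator ?B x)"
        by (auto split: split_indicator)
    qed
    also have "\<dots> = ennreal (2 powr p) * ((\<integral>\<^sup>+ x. ennreal (\<bar>u x - m k\<bar> powr p) * indicator ?B x \<partial>lebesgue)
        + (\<integral>\<^sup>+ x. ennreal (\<bar>u x - m 0\<bar> powr p) * indicator ?B x \<partial>lebesgue))"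
      by (simp add: nn_integral_cmult nn_integral_add)
    also have "\<dots> \<le> ennreal (2 powr p) * (ennreal E + ennreal E)"
      by (intro mult_left_mono add_mono m1) simp
    also have "\<dots> = ennreal (2 powr p * (2 * E))"
      using E by (simp flip: ennreal_mult ennreal_plus)
    finally have "\<bar>m k - m 0\<bar> powr p * ?b \<le> 2 powr p * (2 * E)" using E by (simp add: ennreal_le_iff)
    then have "\<bar>m k - m 0\<bar> powr p \<le> 2 powr p * (2 * E) / ?b" using b by (simp add: field_simps)
    then have "(\<bar>m k - m 0\<bar> powr p) powr (1 / p) \<le> M"
      unfolding M_def using p by (intro powr_mono2) auto
    then show ?thesis using p by (simp add: powr_powr)
  qed
  have "m k \<in> cball (m 0) M" for k using bound[of k] by (simp add: dist_real_def abs_minus_commute)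
  then obtain c and s :: "nat \<Rightarrow> nat" where s: "strict_mono s" and lim: "(m \<circ> s) \<longlonglongrightarrow> c"
    using compact_cball[of "m 0" M] unfolding compact_def by metis
  \<comment> \<open>For fixed \<open>x\<close> the indicator is eventually 1 because
    \<open>s k \<ge> k\<close>, so \<open>G k x\<close> converges to the full integrand, while each
    \<open>G k\<close> has integral at most \<open>E\<close>.\<close>
  define G where "G k x = ennreal (\<bar>u x - m (s k)\<bar> powr p) * indicator (ball 0 (real (Suc (s k)))) x" for k x
  have [measurable]: "G k \<in> borel_measurable lebesgue" for k unfolding G_def by measurable
  have "(\<integral>\<^sup>+ x. ennreal (\<bar>u x - c\<bar> powr p) \<partial>lebesgue) = (\<integral>\<^sup>+ x. liminf (\<lambda>k. G k x) \<partial>lebesgue)"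
  proof (rule nn_integral_cong)
    fix x
    have "(\<lambda>k. ennreal (\<bar>u x - (m \<circ> s) k\<bar> powr p)) \<longlonglongrightarrow> ennreal (\<bar>u x - c\<bar> powr p)"
      by (intro tendsto_ennrealI tendsto_powr' tendsto_rabs tendsto_diff tendsto_const lim) (use p in auto)
    moreover have "eventually (\<lambda>k. ennreal (\<bar>u x - (m \<circ> s) k\<bar> powr p) = G k x) sequentially"
    proof -
      obtain N :: nat where N: "norm x < real N" using reals_Archimedean2 by blast
      have "ennreal (\<bar>u x - (m \<circ> s) k\<bar> powr p) = G k x" if "k \<ge> N" for k
      proof -
        have "N \<le> s k" using seq_suble[OF s, of k] that by linarith
        then have "x \<in> ball 0 (real (Suc (s k)))" using N by auto
        then show ?thesis by (simp add: G_def)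
      qed
      then show ?thesis by (auto simp: eventually_sequentially)
    qed
    ultimately have "(\<lambda>k. G k x) \<longlonglongrightarrow> ennreal (\<bar>u x - c\<bar> powr p)"
      by (rule Lim_transform_eventually)
    then show "ennreal (\<bar>u x - c\<bar> powr p) = liminf (\<lambda>k. G k x)"
      by (simp add: lim_imp_Liminf)
  qed
  also have "\<dots> \<le> liminf (\<lambda>k. \<integral>\<^sup>+ x. G k x \<partial>lebesgue)"
    by (rule nn_integral_liminf) measurable
  also have "\<dots> \<le> liminf (\<lambda>k::nat. ennreal E)"
    by (intro Liminf_mono always_eventually allI) (use m in \<open>auto simp: G_def\<close>)
  also have "\<dots> = ennreal E" by (simp add: Liminf_const)
  finally show ?thesis by blast
qed

section \<open>The inequalities on balls and on the whole space\<close>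

theorem theorem1p1:
  fixes \<phi> :: "real \<Rightarrow> real" and \<alpha> :: real
  assumes dim: "DIM('a::euclidean_space) \<ge> 2"
    and alpha: "- real DIM('a) < \<alpha>" "\<alpha> < 0"
    and young: "young_function \<phi>"
    and low: "lower_Lambda \<phi> DIM('a) \<alpha> < \<infinity>"
    and up: "upper_Lambda \<phi> DIM('a) \<alpha> < \<infinity>"
  shows "\<exists>C\<ge>1.
     (\<forall>(z::'a) r u. r > 0 \<longrightarrow> in_besov \<phi> \<alpha> (ball z r) u \<longrightarrow>
        Lp_norm (real DIM('a) / \<bar>\<alpha>\<bar>) (ball z r) (\<lambda>x. u x - ball_average (ball z r) u)
          \<le> ennreal (C * besov_seminorm \<phi> \<alpha> (ball z r) u)) \<and>
     (\<forall>u::'a \<Rightarrow> real. in_besov \<phi> \<alpha> UNIV u \<longrightarrow>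
        (INF c::real. Lp_norm (real DIM('a) / \<bar>\<alpha>\<bar>) UNIV (\<lambda>x. u x - c))
          \<le> ennreal (C * besov_seminorm \<phi> \<alpha> UNIV u))"
proof -
  define p where "p = real DIM('a) / \<bar>\<alpha>\<bar>"
  \<comment> \<open>This is where \<open>\<alpha> > - n\<close> enters; recentring at the average
    relies on \<open>p \<ge> 1\<close>.\<close>
  have p: "p \<ge> 1" using alpha by (simp add: p_def field_simps)
  obtain D where D: "D > 0" and med: "\<And>(z::'a) r u lam. r > 0 \<Longrightarrow> lam > 0 \<Longrightarrow>
     u \<in> borel_measurable (lebesgue_on (ball z r)) \<Longrightarrow>
     besov_modular \<phi> \<alpha> (ball z r) u lam \<le> 1 \<Longrightarrow>
     \<exists>m. (\<integral>\<^sup>+ x\<in>ball z r. ennreal (\<bar>u x - m\<bar> powr p) \<partial>lebesgue) \<le> ennreal (D * lam powr p)"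
    using besov_median_bound[OF young alpha(2) up] unfolding p_def by blast
  \<comment> \<open>The median constant times the cost of recentring at the average. On the whole
    space an optimal constant replaces the average, so there \<open>D\<close> itself
    suffices.\<close>
  define D' where "D' = 2 powr p * (1 + 2 powr p) * D"
  have D': "D' > 0" unfolding D'_def using D by (simp add: add_pos_pos)
  define C where "C = max 1 (max (D' powr (1 / p)) (D powr (1 / p)))"
  have C: "C \<ge> 1" "D' powr (1 / p) \<le> C" "D powr (1 / p) \<le> C" by (auto simp: C_def)
  have "Lp_norm p (ball z r) (\<lambda>x. u x - ball_average (ball z r) u)
      \<le> ennreal (C * besov_seminorm \<phi> \<alpha> (ball z r) u)"
    if r: "r > 0" and u: "in_besov \<phi> \<alpha> (ball z r) u" for z :: 'a and r u
  proof (rule le_besov_seminorm)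
    fix lam :: real assume lam: "lam > 0" "besov_modular \<phi> \<alpha> (ball z r) u lam \<le> 1"
    have um: "u \<in> borel_measurable (lebesgue_on (ball z r))" using u by (simp add: in_besov_def)
    obtain m where m: "(\<integral>\<^sup>+ x\<in>ball z r. ennreal (\<bar>u x - m\<bar> powr p) \<partial>lebesgue) \<le> ennreal (D * lam powr p)"
      using med[OF r lam(1) um lam(2)] by blast
    have "(\<integral>\<^sup>+ x\<in>ball z r. ennreal (\<bar>u x - ball_average (ball z r) u\<bar> powr p) \<partial>lebesgue)
        \<le> ennreal (2 powr p * (1 + 2 powr p) * (D * lam powr p))"
      by (rule average_deviation_bound[OF um _ _ p _ m]) (use r D lam in \<open>auto simp: content_ball\<close>)
    then have "Lp_norm p (ball z r) (\<lambda>x. u x - ball_average (ball z r) u) \<le> ennreal (D' powr (1 / p) * lam)"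
      by (intro Lp_norm_le) (use p D' lam in \<open>auto simp: D'_def mult.assoc\<close>)
    also have "\<dots> \<le> ennreal (C * lam)" using C lam by (intro ennreal_leI mult_right_mono) auto
    finally show "Lp_norm p (ball z r) (\<lambda>x. u x - ball_average (ball z r) u) \<le> ennreal (C * lam)" .
  qed (use u C in \<open>auto simp: in_besov_def\<close>)
  moreover have "(INF c::real. Lp_norm p UNIV (\<lambda>x. u x - c)) \<le> ennreal (C * besov_seminorm \<phi> \<alpha> UNIV u)"
    if u: "in_besov \<phi> \<alpha> UNIV u" for u :: "'a \<Rightarrow> real"
  proof (rule le_besov_seminorm)
    fix lam :: real assume lam: "lam > 0" "besov_modular \<phi> \<alpha> UNIV u lam \<le> 1"
    have um: "u \<in> borel_measurable lebesgue" using u by (simp add: in_besov_def lebesgue_on_UNIV_eq)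
    have "\<exists>c. (\<integral>\<^sup>+ x. ennreal (\<bar>u x - c\<bar> powr p) \<partial>lebesgue) \<le> ennreal (D * lam powr p)"
    proof (rule global_deviation_bound[OF um])
      fix r :: real assume r: "r > 0"
      \<comment> \<open>The same \<open>lam\<close> is admissible on every ball, so the bound is
        uniform in \<open>r\<close>.\<close>
      have "besov_modular \<phi> \<alpha> (ball 0 r) u lam \<le> 1"
        by (rule order_trans[OF besov_modular_mono_set[OF subset_UNIV] lam(2)])
      then show "\<exists>m. (\<integral>\<^sup>+ x\<in>ball 0 r. ennreal (\<bar>u x - m\<bar> powr p) \<partial>lebesgue) \<le> ennreal (D * lam powr p)"
        using um r lam(1) by (intro med) (auto intro: measurable_restrict_space1)
    qed (use p D lam in auto)
    then obtain c where "(\<integral>\<^sup>+ x. ennreal (\<bar>u x - c\<bar> powr p) \<partial>lebesgue) \<le> ennreal (D * lam powr p)"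
      by blast
    then have "Lp_norm p UNIV (\<lambda>x. u x - c) \<le> ennreal (D powr (1 / p) * lam)"
      by (intro Lp_norm_le) (use p D lam in auto)
    also have "\<dots> \<le> ennreal (C * lam)" using C lam by (intro ennreal_leI mult_right_mono) auto
    finally show "(INF c::real. Lp_norm p UNIV (\<lambda>x. u x - c)) \<le> ennreal (C * lam)"
      by (rule INF_lower2[OF UNIV_I])
  qed (use u C in \<open>auto simp: in_besov_def\<close>)
  ultimately show ?thesis using C(1) unfolding p_def by blast
qed

end
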